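(* Let $p\ge2$, let $w_j>0$ with $\sum_{j\ge1}w_j=1$, and let $U$ be uniformly distributed on $\mathbb S^{p-1}$. The following are equivalent. (i) The Shannon entropy of the weights is finite: $\sum_{j\ge1}w_j\log\frac{e}{w_j}<\infty$. (ii) For every deterministic sequence $(a_j)_{j\ge1}\subset\mathbb S^{p-1}$, $$\sum_{j\ge1}\frac{w_j}{|a_j^\top U|}<\infty\quad\text{almost surely}.$$ If (i) fails and the directions $A_j$, $j\ge1$, are independent Haar points on $\mathbb S^{p-1}$, then for almost every realized sequence $(A_j)_{j\ge1}$ the series $\sum_{j\ge1}w_j/|A_j^\top u|$ diverges for Haar-almost every $u\in\mathbb S^{p-1}$.
   Context: Here $(w_j)_{j\ge1}$ is a countably infinite sequence, and $1/|a^\top u|=+\infty$ when $a^\top u=0$. *)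

theory Defs
  imports "HOL-Probability.Probability"
begin

text \<open>
  The uniform (Haar) probability measure on the unit sphere, as a measure whose space is
  the sphere with its Borel sigma-algebra. It is the law of the direction of a uniformly
  distributed point of the unit ball (recall \<^prop>\<open>sgn x = x /\<^sub>R norm x\<close>). The lemmas
  below check that it is a probability measure and invariant under all orthogonal maps,
  which are the properties that characterise it.
\<close>

definition uniform_sphere :: "'a::euclidean_space measure" where
  "uniform_sphere =
     restrict_space (distr (uniform_measure lborel (ball 0 1)) borel sgn) (sphere 0 1)"

lemma space_uniform_sphere [simp]: "space uniform_sphere = sphere 0 1"
  by (simp add: uniform_sphere_def space_restrict_space)

lemma sets_uniform_sphere [measurable_cong]:
  "sets uniform_sphere = sets (restrict_space borel (sphere 0 1))"
  by (simp add: uniform_sphere_def sets_restrict_space)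

lemma emeasure_uniform_sphere:
  assumes "B \<in> sets borel" "B \<subseteq> sphere (0::'a::euclidean_space) 1"
  shows "emeasure uniform_sphere B =
    emeasure lborel (ball 0 1 \<inter> sgn -` B) / emeasure lborel (ball (0::'a) 1)"
proof -
  have m: "sgn \<in> measurable (uniform_measure lborel (ball (0::'a) 1)) borel"
    by simp
  have "sgn -` B \<in> sets (lborel :: 'a measure)"
    using measurable_sets_borel[OF borel_measurable_sgn assms(1)] by simp
  then show ?thesis
    using assms unfolding uniform_sphere_def
    by (subst emeasure_restrict_space) (auto simp: emeasure_distr[OF m])
qed

lemma prob_space_uniform_sphere: "prob_space (uniform_sphere :: 'a::euclidean_space measure)"
proof
  have fin: "emeasure lborel (ball (0::'a) 1) \<noteq> \<infinity>"
    using emeasure_lborel_ball_finite[of "0::'a" 1] by (simp add: top.not_eq_extremum)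
  have pos: "emeasure lborel (ball (0::'a) 1) \<noteq> 0"
    using content_ball_gt_0_iff[of "0::'a" 1] by (auto simp: measure_def)
  have "sgn -` sphere (0::'a) 1 = - {0}"
    by (auto simp: norm_sgn)
  then have "ball (0::'a) 1 \<inter> sgn -` sphere 0 1 = ball 0 1 - {0}"
    by auto
  moreover have "emeasure lborel (ball (0::'a) 1 - {0}) = emeasure lborel (ball (0::'a) 1)"
    by (rule emeasure_Diff_null_set) auto
  ultimately show "emeasure uniform_sphere (space (uniform_sphere :: 'a measure)) = 1"
    using fin pos by (simp add: emeasure_uniform_sphere less_top)
qed

lemma emeasure_lborel_orthogonal_vimage:
  fixes f :: "'a::euclidean_space \<Rightarrow> 'a"
  assumes f: "orthogonal_transformation f" and B: "B \<in> sets borel"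
  shows "emeasure lborel (f -` B) = emeasure lborel B"
proof -
  have lin: "linear f" and nrm: "\<And>x. norm (f x) = norm x"
    using f by (auto simp: orthogonal_transformation)
  have fb [measurable]: "f \<in> borel_measurable borel"
    using lin by (intro borel_measurable_continuous_onI linear_continuous_on)
      (simp add: linear_conv_bounded_linear)
  have fB: "f -` B \<in> sets borel"
    using measurable_sets_borel[OF fb B] by simp
  note B [measurable] fB [measurable]
  define D where "D = ball (0::'a) 1"
  have D [measurable]: "D \<in> sets borel"
    by (simp add: D_def)
  have fin: "emeasure lborel D \<noteq> \<infinity>"
    using emeasure_lborel_ball_finite[of "0::'a" 1] by (simp add: D_def top.not_eq_extremum)
  have pos: "emeasure lborel D \<noteq> 0"
    using content_ball_gt_0_iff[of "0::'a" 1] by (auto simp: D_def measure_def)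
  have shift: "(\<integral>\<^sup>+x. h (c + x) \<partial>lborel) = (\<integral>\<^sup>+x. h x \<partial>lborel)"
    if "h \<in> borel_measurable borel" for c :: 'a and h :: "'a \<Rightarrow> ennreal"
    using that by (subst (2) lborel_distr_plus[of c, symmetric]) (simp add: nn_integral_distr)
  have inner1: "(\<integral>\<^sup>+y. indicator D (f y - x) \<partial>lborel) = emeasure lborel D" for x
  proof -
    obtain x' where x': "x = f x'"
      using orthogonal_transformation_surj[OF f] by (metis surjD)
    have "indicator D (f y - x) = (indicator D (- x' + y) :: ennreal)" for y
      using nrm[of "y - x'"] by (auto simp: x' D_def indicator_def linear_diff[OF lin])
    then show ?thesis
      using shift[of "indicator D" "- x'"] by simp
  qed
  have inner2: "(\<integral>\<^sup>+y. indicator B (f y - x) \<partial>lborel) = emeasure lborel (f -` B)" for x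
  proof -
    obtain x' where x': "x = f x'"
      using orthogonal_transformation_surj[OF f] by (metis surjD)
    have "indicator B (f y - x) = (indicator (f -` B) (- x' + y) :: ennreal)" for y
      by (auto simp: x' indicator_def linear_diff[OF lin] linear_add[OF lin] linear_neg[OF lin])
    then show ?thesis
      using shift[of "indicator (f -` B)" "- x'"] by simp
  qed
  have swap: "(\<integral>\<^sup>+x. indicator B x * indicator D (f y - x) \<partial>lborel)
      = (\<integral>\<^sup>+x. indicator B (f y - x) * indicator D x \<partial>lborel)" (is "?l = ?r") for y
  proof -
    have "?r = (\<integral>\<^sup>+x. indicator B (f y - (f y + x)) * indicator D (f y + x) \<partial>lborel)"
      by (rule shift[symmetric]) measurable
    also have "\<dots> = (\<integral>\<^sup>+x. indicator B (- x) * indicator D (f y + x) \<partial>lborel)"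
      by simp
    also have "\<dots> = (\<integral>\<^sup>+x. indicator B (- x) * indicator D (f y + x)
        \<partial>distr lborel borel uminus)"
      using lborel_affine[of "-1" "0::'a"] by (simp add: density_1)
    also have "\<dots> = ?l"
      by (subst nn_integral_distr) auto
    finally show ?thesis by simp
  qed
  have "emeasure lborel B * emeasure lborel D
      = (\<integral>\<^sup>+x. indicator B x * (\<integral>\<^sup>+y. indicator D (f y - x) \<partial>lborel) \<partial>lborel)"
    by (simp add: inner1 nn_integral_multc)
  also have "\<dots> = (\<integral>\<^sup>+x. \<integral>\<^sup>+y. indicator B x * indicator D (f y - x) \<partial>lborel \<partial>lborel)"
    by (simp add: nn_integral_cmult)
  also have "\<dots> = (\<integral>\<^sup>+y. \<integral>\<^sup>+x. indicator B x * indicator D (f y - x) \<partial>lborel \<partial>lborel)"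
    by (rule lborel_pair.Fubini'[symmetric]) measurable
  also have "\<dots> = (\<integral>\<^sup>+y. \<integral>\<^sup>+x. indicator B (f y - x) * indicator D x \<partial>lborel \<partial>lborel)"
    by (simp add: swap)
  also have "\<dots> = (\<integral>\<^sup>+x. \<integral>\<^sup>+y. indicator B (f y - x) * indicator D x \<partial>lborel \<partial>lborel)"
    by (rule lborel_pair.Fubini') measurable
  also have "\<dots> = emeasure lborel (f -` B) * emeasure lborel D"
    by (simp add: nn_integral_multc inner2 nn_integral_cmult)
  finally show ?thesis
    using fin pos by (metis ennreal_mult_cancel_left infinity_ennreal_def mult.commute)
qed

lemma orthogonal_invariant_uniform_sphere:
  fixes f :: "'a::euclidean_space \<Rightarrow> 'a"
  assumes f: "orthogonal_transformation f"
  shows "distr uniform_sphere uniform_sphere f = uniform_sphere"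
proof (rule measure_eqI)
  have lin: "linear f" and nrm: "\<And>x. norm (f x) = norm x"
    using f by (auto simp: orthogonal_transformation)
  have fb: "f \<in> borel_measurable borel"
    using lin by (intro borel_measurable_continuous_onI linear_continuous_on)
      (simp add: linear_conv_bounded_linear)
  have sg: "sgn (f x) = f (sgn x)" for x
    by (simp add: sgn_div_norm nrm linear_scale[OF lin])
  have fm: "f \<in> measurable uniform_sphere uniform_sphere"
    unfolding measurable_cong_sets[OF sets_uniform_sphere sets_uniform_sphere]
    by (intro measurable_restrict_space2 measurable_restrict_space1 fb)
       (auto simp: space_restrict_space nrm)
  fix B :: "'a set"
  assume "B \<in> sets (distr uniform_sphere uniform_sphere f)"
  then have B: "B \<in> sets uniform_sphere"
    by simp
  then have B': "B \<in> sets borel" "B \<subseteq> sphere 0 1"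
    by (auto simp: sets_uniform_sphere sets_restrict_space_iff)
  have vim: "f -` B \<in> sets borel" "f -` B \<subseteq> sphere 0 1"
    using measurable_sets_borel[OF fb B'(1)] B'(2) by (auto simp: nrm subset_iff)
  have "ball 0 1 \<inter> sgn -` B \<in> sets borel"
    using measurable_sets_borel[OF borel_measurable_sgn B'(1)] by simp
  moreover have "f -` (ball 0 1 \<inter> sgn -` B) = ball 0 1 \<inter> sgn -` (f -` B)"
    by (auto simp: nrm sg)
  ultimately have "emeasure lborel (ball 0 1 \<inter> sgn -` (f -` B))
      = emeasure lborel (ball 0 1 \<inter> sgn -` B)"
    using emeasure_lborel_orthogonal_vimage[OF f] by metis
  moreover have "f -` B \<inter> sphere 0 1 = f -` B"
    using vim(2) by auto
  ultimately show
    "emeasure (distr uniform_sphere uniform_sphere f) B = emeasure uniform_sphere B"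
    using B B' vim by (simp add: emeasure_distr[OF fm] emeasure_uniform_sphere)
qed simp

end

theory Submission
  imports Defs
begin

text \<open>
  Everything rests on one estimate. In dimension at least two, the distribution function of
  \<open>Y = \<bar>a \<bullet> U\<bar>\<close> lies between \<open>c t\<close> and \<open>C t\<close> on \<open>[0, 1]\<close>, with constants that do not depend on the unit
  vector \<open>a\<close> (\<open>uniform_sphere_slab_bounds\<close>). Hence \<open>w / Y\<close> just fails to be integrable, and
  truncating it at \<open>1\<close>, that is, replacing it by \<open>min 1 (w / Y) = w / max Y w\<close>, leaves an
  expectation comparable to \<open>w ln (e / w)\<close> (\<open>nn_integral_inverse_max_le\<close> and
  \<open>nn_integral_inverse_max_ge\<close>). The entropy of the weights is therefore, up to constants, the sum of
  the expectations of the truncated terms.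

  If the entropy is finite, the truncated series converges almost surely by monotone convergence,
  whatever the dependence between its terms, and almost surely it agrees with the
  original series from some index on (\<open>AE_suminf_divide_finite\<close>).

  If the entropy is infinite and the directions are independent, then for a fixed \<open>u\<close> the
  truncated terms are independent, bounded by \<open>1\<close>, and have divergent expectations, so the series
  diverges almost surely (\<open>AE_suminf_indep_eq_top\<close>). Since \<open>\<bar>a \<bullet> u\<bar>\<close> is symmetric in \<open>a\<close> and \<open>u\<close>, the
  same slab estimate serves here with the direction random and \<open>u\<close> fixed. Fubini's theorem exchanges
  the quantifiers over the directions and over \<open>u\<close>. Applied to the coordinates of an infinite
  product of spheres, this yields a deterministic sequence that violates the almost sure
  convergence, which is the remaining implication of the equivalence.
\<close>

section \<open>The law of the inner product with a uniform direction\<close>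

text \<open>
  Rotating \<open>a\<close> to \<open>b\<close> shows that the constants in the slab estimates below can be chosen
  independently of the direction; it suffices to treat a coordinate vector.
\<close>

lemma emeasure_slab_rotate:
  fixes a b :: "real ^ 'p"
  assumes "norm a = norm b"
  shows "emeasure lborel {x \<in> ball 0 1. x \<noteq> 0 \<and> \<bar>a \<bullet> x\<bar> \<le> t * norm x}
       = emeasure lborel {x \<in> ball 0 1. x \<noteq> 0 \<and> \<bar>b \<bullet> x\<bar> \<le> t * norm x}"
proof -
  obtain f where f: "orthogonal_transformation f" and fa: "f a = b"
    using orthogonal_transformation_exists[OF assms] .
  have nrm: "norm (f x) = norm x" for x
    using f by (simp add: orthogonal_transformation)
  have inner: "b \<bullet> f x = a \<bullet> x" for x
    using f by (simp add: orthogonal_transformation_def flip: fa)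
  have zero: "f x = 0 \<longleftrightarrow> x = 0" for x
    using nrm[of x] by (metis norm_eq_zero)
  have eq: "{x \<in> ball 0 1. x \<noteq> 0 \<and> \<bar>a \<bullet> x\<bar> \<le> t * norm x}
      = f -` {x \<in> ball 0 1. x \<noteq> 0 \<and> \<bar>b \<bullet> x\<bar> \<le> t * norm x}"
    by (simp add: vimage_def nrm inner zero)
  show ?thesis
    unfolding eq by (rule emeasure_lborel_orthogonal_vimage[OF f]) measurable
qed

lemma emeasure_uniform_sphere_slab:
  fixes a :: "real ^ 'p"
  shows "emeasure uniform_sphere {x \<in> sphere 0 1. \<bar>a \<bullet> x\<bar> \<le> t}
       = emeasure lborel {x \<in> ball 0 1. x \<noteq> 0 \<and> \<bar>a \<bullet> x\<bar> \<le> t * norm x}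
         / emeasure lborel (ball (0 :: real ^ 'p) 1)"
proof -
  have eq: "ball 0 1 \<inter> sgn -` {x \<in> sphere 0 1. \<bar>a \<bullet> x\<bar> \<le> t}
      = {x \<in> ball 0 1. x \<noteq> 0 \<and> \<bar>a \<bullet> x\<bar> \<le> t * norm x}"
    by (auto simp: norm_sgn sgn_div_norm abs_mult field_simps split: if_splits)
  show ?thesis
    unfolding eq[symmetric] by (rule emeasure_uniform_sphere) (measurable, blast)
qed

text \<open>
  In the unit ball, the directions counted here fill the conical neighbourhood
  \<open>\<bar>a \<bullet> x\<bar> \<le> t * norm x\<close> of the hyperplane orthogonal to \<open>a\<close>. It lies between two boxes of
  thickness proportional to \<open>t\<close>: one that contains it, and one inside it that stays away from the
  origin. For the latter there must be a second coordinate to move along, hence the dimension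
  bound; for the two-point sphere of the line the lower bound fails for \<open>0 < t < 1\<close>.
\<close>

lemma uniform_sphere_slab_bounds:
  assumes p: "CARD('p) \<ge> 2"
  obtains c C :: real where "c > 0"
    "\<And>(a :: real ^ 'p) t. norm a = 1 \<Longrightarrow> 0 \<le> t \<Longrightarrow> t \<le> 1 \<Longrightarrow>
       ennreal (c * t) \<le> emeasure uniform_sphere {x \<in> sphere 0 1. \<bar>a \<bullet> x\<bar> \<le> t}"
    "\<And>(a :: real ^ 'p) t. norm a = 1 \<Longrightarrow> 0 \<le> t \<Longrightarrow> t \<le> 1 \<Longrightarrow>
       emeasure uniform_sphere {x \<in> sphere 0 1. \<bar>a \<bullet> x\<bar> \<le> t} \<le> ennreal (C * t)"
proof -
  obtain k :: 'p where True by blast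
  obtain k' :: 'p where k': "k' \<noteq> k"
  proof -
    have "UNIV \<noteq> {k}"
    proof
      assume "UNIV = {k}"
      then have "CARD('p) = card {k}" by (rule arg_cong)
      then show False using p by simp
    qed
    then show ?thesis using that by blast
  qed
  define v where "v = measure lborel (ball (0 :: real ^ 'p) 1)"
  have v: "v > 0"
    unfolding v_def by simp
  have V: "emeasure lborel (ball (0 :: real ^ 'p) 1) = ennreal v"
    unfolding v_def
    by (rule emeasure_eq_ennreal_measure)
      (use emeasure_lborel_ball_finite[of "0 :: real ^ 'p" 1] in \<open>simp add: top.not_eq_extremum\<close>)
  \<comment> \<open>With this \<open>\<delta>\<close> the inner box, whose \<open>k'\<close>-th side is \<open>[1/2, 3/4]\<close> and whose other sides lie in
      \<open>[-\<delta>, \<delta>]\<close>, is inside the unit ball because its points have sum norm below \<open>1\<close>.\<close>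
  define \<delta> where "\<delta> = 1 / (4 * real CARD('p))"
  have \<delta>: "\<delta> > 0" "\<delta> \<le> 1/8" using p by (auto simp: \<delta>_def field_simps)
  define S where "S t = {x :: real ^ 'p. x \<in> ball 0 1 \<and> x \<noteq> 0 \<and> \<bar>axis k 1 \<bullet> x\<bar> \<le> t * norm x}" for t
  have S [measurable]: "S t \<in> sets borel" for t
    unfolding S_def by measurable
  have red: "emeasure uniform_sphere {x \<in> sphere 0 1. \<bar>a \<bullet> x\<bar> \<le> t} = emeasure lborel (S t) / ennreal v"
    if "norm a = 1" for a :: "real ^ 'p" and t
    unfolding emeasure_uniform_sphere_slab S_def V
    by (subst emeasure_slab_rotate[of a "axis k 1"]) (simp_all add: that)
  have box: "emeasure lborel (cbox l u) = ennreal (\<Prod>i\<in>UNIV. u $ i - l $ i)"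
    if "\<And>i. l $ i \<le> u $ i" for l u :: "real ^ 'p"
  proof -
    have "cbox l u \<noteq> {}"
      using that by (simp add: interval_ne_empty_cart)
    from content_cbox_cart[OF this] show ?thesis
      by (subst emeasure_eq_ennreal_measure)
         (use emeasure_lborel_cbox_finite[of l u] in \<open>auto simp: top.not_eq_extremum\<close>)
  qed
  have split: "(\<Prod>i\<in>UNIV. if i = k then x else g i) = x * (\<Prod>i\<in>UNIV - {k}. g i)" for x :: real and g
    by (subst prod.remove[of _ k]) (auto intro!: arg_cong2[where f="(*)"] prod.cong)
  have upper: "emeasure lborel (S t) \<le> ennreal (2 * t * 2 ^ (CARD('p) - 1))" if "0 \<le> t" "t \<le> 1" for t
  proof -
    define u :: "real ^ 'p" where "u = (\<chi> i. if i = k then t else 1)"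
    have "S t \<subseteq> cbox (- u) u"
    proof
      fix x assume x: "x \<in> S t"
      have "\<bar>x $ i\<bar> \<le> u $ i" for i
      proof (cases "i = k")
        case True
        have "\<bar>x $ k\<bar> \<le> t * norm x" using x by (simp add: S_def inner_axis')
        also have "\<dots> \<le> t" using x that by (auto simp: S_def intro: mult_left_le)
        finally show ?thesis by (simp add: u_def True)
      next
        case False
        then show ?thesis
          using component_le_norm_cart[of x i] x by (simp add: u_def S_def)
      qed
      then show "x \<in> cbox (- u) u"
        by (simp add: mem_box_cart abs_le_iff minus_le_iff)
    qed
    then have "emeasure lborel (S t) \<le> emeasure lborel (cbox (- u) u)"
      by (intro emeasure_mono) auto
    also have "\<dots> = ennreal (\<Prod>i\<in>UNIV. if i = k then 2 * t else 2)"
      by (subst box) (auto simp: u_def that intro!: prod.cong arg_cong[where f=ennreal])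
    also have "\<dots> = ennreal (2 * t * 2 ^ (CARD('p) - 1))"
      by (simp add: split card_Diff_singleton)
    finally show ?thesis .
  qed
  define P where "P = (\<Prod>i\<in>UNIV - {k}. if i = k' then 1/4 else 2 * \<delta>)"
  have P: "P > 0"
    unfolding P_def by (intro prod_pos) (auto simp: \<delta>)
  have lower: "ennreal (2 * (t * \<delta>) * P) \<le> emeasure lborel (S t)" if "0 \<le> t" "t \<le> 1" for t
  proof -
    define l :: "real ^ 'p" where "l = (\<chi> i. if i = k then - (t * \<delta>) else if i = k' then 1/2 else - \<delta>)"
    define u :: "real ^ 'p" where "u = (\<chi> i. if i = k then t * \<delta> else if i = k' then 3/4 else \<delta>)"
    have t\<delta>: "t * \<delta> \<le> \<delta>" "0 \<le> t * \<delta>"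
      using that \<delta> by (auto intro: mult_left_le_one_le)
    have "cbox l u \<subseteq> S t"
    proof
      fix x assume "x \<in> cbox l u"
      then have x: "l $ i \<le> x $ i" "x $ i \<le> u $ i" for i
        by (auto simp: mem_box_cart)
      have xk: "\<bar>x $ k\<bar> \<le> t * \<delta>" and xk': "1/2 \<le> x $ k'" "x $ k' \<le> 3/4"
        using x[of k] x[of k'] k' by (auto simp: l_def u_def)
      have xi: "\<bar>x $ i\<bar> \<le> \<delta>" if "i \<noteq> k'" for i
        using x[of i] xk t\<delta> that by (cases "i = k") (auto simp: l_def u_def)
      have "norm x \<le> (\<Sum>i\<in>UNIV. \<bar>x $ i\<bar>)"
        by (rule norm_le_l1_cart)
      also have "\<dots> = \<bar>x $ k'\<bar> + (\<Sum>i\<in>UNIV - {k'}. \<bar>x $ i\<bar>)"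
        by (rule sum.remove) auto
      also have "\<dots> \<le> 3/4 + (\<Sum>i\<in>UNIV - {k'}. \<delta>)"
        using xk' xi by (intro add_mono sum_mono) auto
      also have "\<dots> = 3/4 + real (CARD('p) - 1) * \<delta>"
        by (simp add: card_Diff_singleton)
      also have "\<dots> < 1"
        using p by (simp add: \<delta>_def field_simps)
      finally have n1: "norm x < 1" .
      have n2: "norm x \<ge> 1/2"
        using component_le_norm_cart[of x k'] xk' by simp
      have "t * \<delta> \<le> t * norm x"
        using n2 \<delta> that by (intro mult_left_mono) auto
      then show "x \<in> S t"
        using n1 n2 xk by (auto simp: S_def inner_axis')
    qed
    then have "emeasure lborel (cbox l u) \<le> emeasure lborel (S t)"
      by (intro emeasure_mono) auto
    moreover have "emeasure lborel (cbox l u)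
        = ennreal (\<Prod>i\<in>UNIV. if i = k then 2 * (t * \<delta>) else if i = k' then 1/4 else 2 * \<delta>)"
      using t\<delta> \<delta> by (subst box) (auto simp: u_def l_def intro!: prod.cong arg_cong[where f=ennreal])
    ultimately show ?thesis
      by (simp add: split P_def)
  qed
  show ?thesis
  proof (rule that[of "2 * \<delta> * P / v" "2 * 2 ^ (CARD('p) - 1) / v"])
    show "2 * \<delta> * P / v > 0"
      using \<delta> P v by simp
  next
    fix a :: "real ^ 'p" and t :: real
    assume "norm a = 1" and t: "0 \<le> t" "t \<le> 1"
    have "ennreal (2 * \<delta> * P / v * t) = ennreal (2 * (t * \<delta>) * P) / ennreal v"
      using \<delta> P v t by (subst divide_ennreal) (auto simp: mult_ac)
    also have "\<dots> \<le> emeasure lborel (S t) / ennreal v"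
      by (intro divide_right_mono_ennreal lower t)
    finally show "ennreal (2 * \<delta> * P / v * t) \<le> emeasure uniform_sphere {x \<in> sphere 0 1. \<bar>a \<bullet> x\<bar> \<le> t}"
      unfolding red[OF \<open>norm a = 1\<close>] .
    have "emeasure lborel (S t) / ennreal v \<le> ennreal (2 * t * 2 ^ (CARD('p) - 1)) / ennreal v"
      by (intro divide_right_mono_ennreal upper t)
    also have "\<dots> = ennreal (2 * 2 ^ (CARD('p) - 1) / v * t)"
      using v t by (subst divide_ennreal) (auto simp: mult_ac)
    finally show "emeasure uniform_sphere {x \<in> sphere 0 1. \<bar>a \<bullet> x\<bar> \<le> t} \<le> ennreal (2 * 2 ^ (CARD('p) - 1) / v * t)"
      unfolding red[OF \<open>norm a = 1\<close>] .
  qed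
qed

lemma measurable_ident_uniform_sphere [measurable]: "(\<lambda>x. x) \<in> borel_measurable uniform_sphere"
  unfolding measurable_cong_sets[OF sets_uniform_sphere refl]
  by (rule measurable_restrict_space1) simp

section \<open>Expectation of a truncated reciprocal\<close>

text \<open>
  The truncated reciprocal is written as an integral of the indicators of \<open>y \<le> t\<close>, so that taking
  expectations turns it into an integral of the distribution function.
\<close>

lemma inverse_max_layer_cake:
  fixes y w :: real
  assumes "0 \<le> y" "y \<le> 1" "0 < w" "w \<le> 1"
  shows "ennreal (1 / max y w)
       = 1 + (\<integral>\<^sup>+t. ennreal (1 / t\<^sup>2) * indicator {w..1} t * (if y \<le> t then 1 else 0) \<partial>lborel)"
proof -
  define m where "m = max y w"
  have m: "0 < m" "m \<le> 1" using assms by (auto simp: m_def)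
  have "(\<integral>\<^sup>+t. ennreal (1 / t\<^sup>2) * indicator {w..1} t * (if y \<le> t then 1 else 0) \<partial>lborel)
      = (\<integral>\<^sup>+t. ennreal (1 / t\<^sup>2) * indicator {m..1} t \<partial>lborel)"
    by (intro nn_integral_cong) (auto simp: m_def split: split_indicator)
  also have "\<dots> = ennreal ((- 1 / 1) - (- 1 / m))"
  proof (rule nn_integral_FTC_Icc)
    fix t assume t: "t \<in> {m..1}"
    show "((\<lambda>t. - 1 / t) has_real_derivative 1 / t\<^sup>2) (at t)"
      using m t by (auto intro!: derivative_eq_intros simp: power2_eq_square)
  qed (use m in auto)
  finally have "(\<integral>\<^sup>+t. ennreal (1 / t\<^sup>2) * indicator {w..1} t * (if y \<le> t then 1 else 0) \<partial>lborel)
      = ennreal (1 / m - 1)"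
    by (simp add: algebra_simps)
  moreover have "1 + ennreal (1 / m - 1) = ennreal (1 + (1 / m - 1))"
    using m by (subst ennreal_plus) (auto simp: field_simps)
  ultimately show ?thesis
    by (simp add: m_def)
qed

lemma nn_integral_inverse_eq_ln:
  fixes w K :: real
  assumes "0 < w" "w \<le> 1" "0 \<le> K"
  shows "(\<integral>\<^sup>+t. ennreal (1 / t\<^sup>2) * indicator {w..1} t * ennreal (K * t) \<partial>lborel) = ennreal (K * - ln w)"
proof -
  have "(\<integral>\<^sup>+t. ennreal (1 / t\<^sup>2) * indicator {w..1} t * ennreal (K * t) \<partial>lborel)
      = (\<integral>\<^sup>+t. ennreal (K / t) * indicator {w..1} t \<partial>lborel)"
    using assms by (intro nn_integral_cong)
      (auto split: split_indicator simp: power2_eq_square simp flip: ennreal_mult')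
  also have "\<dots> = ennreal (K * ln 1 - K * ln w)"
  proof (rule nn_integral_FTC_Icc)
    fix t assume t: "t \<in> {w..1}"
    show "((\<lambda>t. K * ln t) has_real_derivative K / t) (at t)"
      using assms t by (auto intro!: derivative_eq_intros)
  qed (use assms in auto)
  finally show ?thesis by simp
qed

context prob_space
begin

lemma nn_integral_inverse_max:
  assumes Y [measurable]: "random_variable borel Y"
    and Y01: "\<And>\<omega>. \<omega> \<in> space M \<Longrightarrow> 0 \<le> Y \<omega> \<and> Y \<omega> \<le> 1"
    and w: "0 < w" "w \<le> (1::real)"
  shows "(\<integral>\<^sup>+\<omega>. ennreal (w / max (Y \<omega>) w) \<partial>M) = ennreal w *
    (1 + (\<integral>\<^sup>+t. ennreal (1 / t\<^sup>2) * indicator {w..1} t * emeasure M {\<omega> \<in> space M. Y \<omega> \<le> t} \<partial>lborel))"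
proof -
  interpret pair_sigma_finite lborel M ..
  have "(\<integral>\<^sup>+\<omega>. ennreal (w / max (Y \<omega>) w) \<partial>M) = (\<integral>\<^sup>+\<omega>. ennreal w * (1 +
      (\<integral>\<^sup>+t. ennreal (1 / t\<^sup>2) * indicator {w..1} t * (if Y \<omega> \<le> t then 1 else 0) \<partial>lborel)) \<partial>M)"
  proof (rule nn_integral_cong)
    fix \<omega> assume \<omega>: "\<omega> \<in> space M"
    have "ennreal (w / max (Y \<omega>) w) = ennreal w * ennreal (1 / max (Y \<omega>) w)"
      using w by (subst ennreal_mult'[symmetric]) auto
    with inverse_max_layer_cake[of "Y \<omega>" w] Y01[OF \<omega>] w
    show "ennreal (w / max (Y \<omega>) w) = ennreal w * (1 +
      (\<integral>\<^sup>+t. ennreal (1 / t\<^sup>2) * indicator {w..1} t * (if Y \<omega> \<le> t then 1 else 0) \<partial>lborel))"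
      by simp
  qed
  also have "\<dots> = ennreal w * (1 +
      (\<integral>\<^sup>+\<omega>. \<integral>\<^sup>+t. ennreal (1 / t\<^sup>2) * indicator {w..1} t * (if Y \<omega> \<le> t then 1 else 0) \<partial>lborel \<partial>M))"
    by (simp add: nn_integral_cmult nn_integral_add emeasure_space_1)
  also have "(\<integral>\<^sup>+\<omega>. \<integral>\<^sup>+t. ennreal (1 / t\<^sup>2) * indicator {w..1} t * (if Y \<omega> \<le> t then 1 else 0) \<partial>lborel \<partial>M)
      = (\<integral>\<^sup>+t. \<integral>\<^sup>+\<omega>. ennreal (1 / t\<^sup>2) * indicator {w..1} t * (if Y \<omega> \<le> t then 1 else 0) \<partial>M \<partial>lborel)"
    by (rule Fubini') measurable
  also have "\<dots> = (\<integral>\<^sup>+t. ennreal (1 / t\<^sup>2) * indicator {w..1} t * emeasure M {\<omega> \<in> space M. Y \<omega> \<le> t} \<partial>lborel)"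
  proof (rule nn_integral_cong)
    fix t :: real
    have "(\<integral>\<^sup>+\<omega>. (if Y \<omega> \<le> t then 1 else 0) \<partial>M) = (\<integral>\<^sup>+\<omega>. indicator {\<omega> \<in> space M. Y \<omega> \<le> t} \<omega> \<partial>M)"
      by (intro nn_integral_cong) (auto split: split_indicator)
    then show "(\<integral>\<^sup>+\<omega>. ennreal (1 / t\<^sup>2) * indicator {w..1} t * (if Y \<omega> \<le> t then 1 else 0) \<partial>M)
        = ennreal (1 / t\<^sup>2) * indicator {w..1} t * emeasure M {\<omega> \<in> space M. Y \<omega> \<le> t}"
      by (simp add: nn_integral_cmult)
  qed
  finally show ?thesis .
qed

text \<open>
  This is where the entropy comes from: a distribution function comparable to \<open>t\<close> contributes
  \<open>\<integral> t / t\<^sup>2 dt = - ln w\<close> over \<open>[w, 1]\<close>, and the constant term \<open>1\<close> of the layer-cake formula completes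
  this to \<open>1 - ln w = ln (e / w)\<close>. Taking \<open>t = 1\<close> in the hypotheses gives \<open>c \<le> 1 \<le> C\<close>, so that the
  same constants also bound that constant term.
\<close>

lemma
  assumes Y: "random_variable borel Y"
    and Y01: "\<And>\<omega>. \<omega> \<in> space M \<Longrightarrow> 0 \<le> Y \<omega> \<and> Y \<omega> \<le> 1"
    and w: "0 < w" "w \<le> (1::real)"
  shows nn_integral_inverse_max_le:
    "\<lbrakk>\<And>t. 0 \<le> t \<Longrightarrow> t \<le> 1 \<Longrightarrow> emeasure M {\<omega> \<in> space M. Y \<omega> \<le> t} \<le> ennreal (C * t)\<rbrakk> \<Longrightarrow>
      (\<integral>\<^sup>+\<omega>. ennreal (w / max (Y \<omega>) w) \<partial>M) \<le> ennreal (C * (w * ln (exp 1 / w)))"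
    and nn_integral_inverse_max_ge:
    "\<lbrakk>0 < c; \<And>t. 0 \<le> t \<Longrightarrow> t \<le> 1 \<Longrightarrow> ennreal (c * t) \<le> emeasure M {\<omega> \<in> space M. Y \<omega> \<le> t}\<rbrakk> \<Longrightarrow>
      ennreal (c * (w * ln (exp 1 / w))) \<le> (\<integral>\<^sup>+\<omega>. ennreal (w / max (Y \<omega>) w) \<partial>M)"
proof -
  have at1: "emeasure M {\<omega> \<in> space M. Y \<omega> \<le> 1} = 1"
    using Y01 emeasure_space_1 by (metis (no_types, lifting) Collect_cong Collect_mem_eq)
  have log: "ln (exp 1 / w) = 1 - ln w"
    using w by (simp add: ln_div)
  have lnw: "ln w \<le> 0"
    using w by simp
  have collect: "ennreal w * (ennreal K + ennreal (K * - ln w)) = ennreal (K * (w * ln (exp 1 / w)))"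
    if "0 \<le> K" for K
    using that w lnw by (subst ennreal_plus[symmetric])
      (auto simp: log algebra_simps mult_nonneg_nonpos simp flip: ennreal_mult')
  {
    assume C: "\<And>t. 0 \<le> t \<Longrightarrow> t \<le> 1 \<Longrightarrow> emeasure M {\<omega> \<in> space M. Y \<omega> \<le> t} \<le> ennreal (C * t)"
    have C1: "1 \<le> C"
      using C[of 1] at1 by (simp add: ennreal_le_iff2 flip: ennreal_1 del: ennreal_1)
    have "(\<integral>\<^sup>+t. ennreal (1 / t\<^sup>2) * indicator {w..1} t * emeasure M {\<omega> \<in> space M. Y \<omega> \<le> t} \<partial>lborel)
        \<le> (\<integral>\<^sup>+t. ennreal (1 / t\<^sup>2) * indicator {w..1} t * ennreal (C * t) \<partial>lborel)"
      using C w by (intro nn_integral_mono) (auto split: split_indicator intro!: mult_left_mono)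
    also have "\<dots> = ennreal (C * - ln w)"
      using C1 w by (intro nn_integral_inverse_eq_ln) auto
    finally have "ennreal w * (1 + (\<integral>\<^sup>+t. ennreal (1 / t\<^sup>2) * indicator {w..1} t *
        emeasure M {\<omega> \<in> space M. Y \<omega> \<le> t} \<partial>lborel)) \<le> ennreal w * (ennreal C + ennreal (C * - ln w))"
      using C1 by (intro mult_left_mono add_mono) (auto simp flip: ennreal_1)
    then show "(\<integral>\<^sup>+\<omega>. ennreal (w / max (Y \<omega>) w) \<partial>M) \<le> ennreal (C * (w * ln (exp 1 / w)))"
      using C1 collect[of C] by (simp only: nn_integral_inverse_max[OF Y Y01 w])
  }
  {
    assume c: "0 < c" "\<And>t. 0 \<le> t \<Longrightarrow> t \<le> 1 \<Longrightarrow> ennreal (c * t) \<le> emeasure M {\<omega> \<in> space M. Y \<omega> \<le> t}"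
    have c1: "c \<le> 1"
      using c(2)[of 1] at1 by (simp add: ennreal_le_iff2 flip: ennreal_1 del: ennreal_1)
    have "ennreal (c * - ln w)
        = (\<integral>\<^sup>+t. ennreal (1 / t\<^sup>2) * indicator {w..1} t * ennreal (c * t) \<partial>lborel)"
      using c w by (intro nn_integral_inverse_eq_ln[symmetric]) auto
    also have "\<dots> \<le> (\<integral>\<^sup>+t. ennreal (1 / t\<^sup>2) * indicator {w..1} t * emeasure M {\<omega> \<in> space M. Y \<omega> \<le> t} \<partial>lborel)"
      using c w by (intro nn_integral_mono) (auto split: split_indicator intro!: mult_left_mono)
    finally have "ennreal w * (ennreal c + ennreal (c * - ln w)) \<le> ennreal w * (1 + (\<integral>\<^sup>+t. ennreal (1 / t\<^sup>2) * indicator {w..1} t *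
        emeasure M {\<omega> \<in> space M. Y \<omega> \<le> t} \<partial>lborel))"
      using c1 by (intro mult_left_mono add_mono) (auto simp flip: ennreal_1)
    then show "ennreal (c * (w * ln (exp 1 / w))) \<le> (\<integral>\<^sup>+\<omega>. ennreal (w / max (Y \<omega>) w) \<partial>M)"
      using c(1) collect[of c] by (simp only: nn_integral_inverse_max[OF Y Y01 w] less_imp_le)
  }
qed

section \<open>Almost sure convergence and divergence of random series\<close>

text \<open>
  The truncated series has finite expectation, so it converges almost surely. Its terms then tend
  to \<open>0\<close>, and a term below \<open>1\<close> is one that the truncation has not changed, so from some index on the
  truncation does nothing. The finitely many other terms are finite because the tail bound at \<open>t = 0\<close> gives \<open>Y j > 0\<close> almost surely.
\<close>

lemma AE_suminf_divide_finite:
  fixes Y :: "nat \<Rightarrow> 'a \<Rightarrow> real" and w :: "nat \<Rightarrow> real"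
  assumes w: "\<And>j. 0 < w j" "\<And>j. w j \<le> 1"
    and entropy: "summable (\<lambda>j. w j * ln (exp 1 / w j))"
    and Y [measurable]: "\<And>j. random_variable borel (Y j)"
    and Y01: "\<And>j \<omega>. \<omega> \<in> space M \<Longrightarrow> 0 \<le> Y j \<omega> \<and> Y j \<omega> \<le> 1"
    and tail: "\<And>j t. 0 \<le> t \<Longrightarrow> t \<le> 1 \<Longrightarrow> emeasure M {\<omega> \<in> space M. Y j \<omega> \<le> t} \<le> ennreal (C * t)"
  shows "AE \<omega> in M. (\<Sum>j. ennreal (w j) / ennreal (Y j \<omega>)) < \<infinity>"
proof -
  have C: "0 \<le> C"
  proof -
    have "{\<omega> \<in> space M. Y 0 \<omega> \<le> 1} = space M" using Y01 by auto
    then show ?thesis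
      using tail[of 1 0] by (simp add: emeasure_space_1 ennreal_le_iff2 flip: ennreal_1 del: ennreal_1)
  qed
  have wln: "0 \<le> w j * ln (exp 1 / w j)" for j
    using w[of j] by (intro mult_nonneg_nonneg ln_ge_zero) (auto simp: field_simps intro: order_trans[of _ 1])
  have "(\<integral>\<^sup>+\<omega>. (\<Sum>j. ennreal (w j / max (Y j \<omega>) (w j))) \<partial>M)
      = (\<Sum>j. \<integral>\<^sup>+\<omega>. ennreal (w j / max (Y j \<omega>) (w j)) \<partial>M)"
    by (intro nn_integral_suminf) measurable
  also have "\<dots> \<le> (\<Sum>j. ennreal (C * (w j * ln (exp 1 / w j))))"
    by (intro suminf_le nn_integral_inverse_max_le Y Y01 w tail) auto
  also have "\<dots> < \<infinity>"
    using summable_mult[OF entropy, of C] C wln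
    by (simp add: ennreal_suminf_neq_top less_top[symmetric])
  finally have "AE \<omega> in M. (\<Sum>j. ennreal (w j / max (Y j \<omega>) (w j))) \<noteq> \<infinity>"
    by (intro nn_integral_noteq_infinite) auto
  moreover have "AE \<omega> in M. 0 < Y j \<omega>" for j
  proof -
    have "{\<omega> \<in> space M. Y j \<omega> \<le> 0} \<in> null_sets M"
      using tail[of 0 j] by (intro null_setsI) auto
    then show ?thesis
      by (rule AE_I') (auto simp: not_less)
  qed
  then have "AE \<omega> in M. \<forall>j. 0 < Y j \<omega>"
    by (simp add: AE_all_countable)
  ultimately show ?thesis
  proof eventually_elim
    case (elim \<omega>)
    then have pos: "0 < Y j \<omega>" for j by blast
    have sm: "summable (\<lambda>j. w j / max (Y j \<omega>) (w j))"
      using elim(1) summable_iff_suminf_neq_top[of "\<lambda>j. w j / max (Y j \<omega>) (w j)"] w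
      by (force simp: less_max_iff_disj less_imp_le intro!: divide_nonneg_nonneg)
    have "eventually (\<lambda>j. w j / max (Y j \<omega>) (w j) < 1) sequentially"
      using summable_LIMSEQ_zero[OF sm] by (rule order_tendstoD) simp
    then have "eventually (\<lambda>j. w j / Y j \<omega> = w j / max (Y j \<omega>) (w j)) sequentially"
    proof eventually_elim
      case (elim j)
      then have "w j \<le> Y j \<omega>"
        using w(1)[of j] by (cases "w j \<le> Y j \<omega>") (auto simp: max_def)
      then show ?case by (simp add: max_def)
    qed
    then have "summable (\<lambda>j. w j / Y j \<omega>)"
      using sm summable_cong by fastforce
    then have "(\<Sum>j. ennreal (w j / Y j \<omega>)) \<noteq> top"
      using pos w by (intro ennreal_suminf_neq_top) (auto simp: less_imp_le)
    moreover have "ennreal (w j) / ennreal (Y j \<omega>) = ennreal (w j / Y j \<omega>)" for j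
      using pos w by (simp add: divide_ennreal less_imp_le)
    ultimately show ?case
      by (simp add: less_top)
  qed
qed

text \<open>
  The divergence half of the three-series theorem for independent variables in \<open>[0, 1]\<close>. By
  independence the expectation of \<open>exp (- (Z\<^sub>0 + ... + Z\<^sub>n))\<close> factorises, each factor is at most
  \<open>exp (- E Z\<^sub>j / 2)\<close>, and the product tends to \<open>0\<close>; so \<open>exp (- \<Sum>Z\<^sub>j)\<close> vanishes almost surely.
\<close>

lemma AE_suminf_indep_eq_top:
  fixes Z :: "nat \<Rightarrow> 'a \<Rightarrow> real"
  assumes indep: "indep_vars (\<lambda>_. borel) Z UNIV"
    and Z01: "\<And>j \<omega>. \<omega> \<in> space M \<Longrightarrow> 0 \<le> Z j \<omega> \<and> Z j \<omega> \<le> 1"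
    and div: "(\<Sum>j. \<integral>\<^sup>+\<omega>. ennreal (Z j \<omega>) \<partial>M) = \<infinity>"
  shows "AE \<omega> in M. (\<Sum>j. ennreal (Z j \<omega>)) = \<infinity>"
proof -
  have Z [measurable]: "random_variable borel (Z j)" for j
    using indep by (simp add: indep_vars_def)
  define e where "e j = expectation (Z j)" for j
  have int: "integrable M (Z j)" for j
    by (rule integrable_const_bound[where B = 1]) (use Z01 in auto)
  have e: "(\<integral>\<^sup>+\<omega>. ennreal (Z j \<omega>) \<partial>M) = ennreal (e j)" "0 \<le> e j" for j
    unfolding e_def using Z01 int by (auto intro!: nn_integral_eq_integral integral_nonneg_AE)
  have factor: "(\<integral>\<^sup>+\<omega>. ennreal (exp (- Z j \<omega>)) \<partial>M) \<le> ennreal (exp (- e j / 2))" for j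
  proof -
    \<comment> \<open>\<open>exp (- z) \<le> 1 / (1 + z) \<le> 1 - z / 2\<close> on \<open>[0, 1]\<close>, and \<open>1 - x \<le> exp (- x)\<close> after integrating.\<close>
    have "exp (- Z j \<omega>) \<le> 1 - Z j \<omega> / 2" if "\<omega> \<in> space M" for \<omega>
    proof -
      have z: "0 \<le> Z j \<omega>" "Z j \<omega> \<le> 1" using Z01 that by auto
      have "exp (- Z j \<omega>) \<le> 1 / (1 + Z j \<omega>)"
        using z exp_ge_add_one_self[of "Z j \<omega>"] by (simp add: exp_minus inverse_eq_divide frac_le)
      also have "1 / (1 + Z j \<omega>) \<le> 1 - Z j \<omega> / 2"
        using z mult_left_le[of "Z j \<omega>" "Z j \<omega>"] by (simp add: field_simps)
      finally show ?thesis .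
    qed
    then have "(\<integral>\<^sup>+\<omega>. ennreal (exp (- Z j \<omega>)) \<partial>M) \<le> (\<integral>\<^sup>+\<omega>. ennreal (1 - Z j \<omega> / 2) \<partial>M)"
      by (intro nn_integral_mono ennreal_leI)
    also have "\<dots> = ennreal (\<integral>\<omega>. 1 - Z j \<omega> / 2 \<partial>M)"
      using Z01 int by (intro nn_integral_eq_integral AE_I2) (auto intro: order_trans[of _ 1])
    also have "(\<integral>\<omega>. 1 - Z j \<omega> / 2 \<partial>M) = 1 - e j / 2"
      using int by (simp add: e_def prob_space)
    also have "1 - e j / 2 \<le> exp (- e j / 2)"
      using exp_ge_add_one_self[of "- e j / 2"] by simp
    finally show ?thesis by (simp add: ennreal_leI)
  qed
  define f where "f n \<omega> = (\<Prod>j<n. ennreal (exp (- Z j \<omega>)))" for n \<omega>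
  have f [measurable]: "f n \<in> borel_measurable M" for n
    unfolding f_def by measurable
  have Ef: "(\<integral>\<^sup>+\<omega>. f n \<omega> \<partial>M) \<le> ennreal (exp (- (\<Sum>j<n. e j) / 2))" for n
  proof -
    have "indep_vars (\<lambda>_. borel) (\<lambda>j \<omega>. ennreal (exp (- Z j \<omega>))) UNIV"
      by (rule indep_vars_compose2[OF indep]) measurable
    then have "(\<integral>\<^sup>+\<omega>. f n \<omega> \<partial>M) = (\<Prod>j<n. \<integral>\<^sup>+\<omega>. ennreal (exp (- Z j \<omega>)) \<partial>M)"
      unfolding f_def by (intro indep_vars_nn_integral) (auto intro: indep_vars_subset)
    also have "\<dots> \<le> (\<Prod>j<n. ennreal (exp (- e j / 2)))"
      by (intro prod_mono_ennreal factor)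
    also have "\<dots> = ennreal (\<Prod>j<n. exp (- e j / 2))"
      by (rule prod_ennreal) simp
    also have "(\<Prod>j<n. exp (- e j / 2)) = exp (\<Sum>j<n. - e j / 2)"
      by (rule exp_sum[symmetric]) simp
    also have "(\<Sum>j<n. - e j / 2) = - (\<Sum>j<n. e j) / 2"
      by (simp only: sum_negf flip: sum_divide_distrib)
    finally show ?thesis .
  qed
  have "(\<lambda>n. \<Sum>j<n. ennreal (e j)) \<longlonglongrightarrow> \<infinity>"
    using div summable_LIMSEQ[OF summableI, of "\<lambda>j. ennreal (e j)"] by (simp only: e(1))
  then have "filterlim (\<lambda>n. \<Sum>j<n. e j) at_top sequentially"
    by (simp only: sum_ennreal[OF e(2)] ennreal_tendsto_top_eq_at_top infinity_ennreal_def)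
  then have "(\<lambda>n. ennreal (exp (- (\<Sum>j<n. e j) / 2))) \<longlonglongrightarrow> ennreal 0"
    by (intro tendsto_ennrealI filterlim_compose[OF exp_at_bot]) (simp add: filterlim_uminus_at_bot filterlim_tendsto_pos_mult_at_top[where c="1/2", OF tendsto_const, simplified])
  moreover have "(\<integral>\<^sup>+\<omega>. (INF n. f n \<omega>) \<partial>M) \<le> ennreal (exp (- (\<Sum>j<n. e j) / 2))" for n
    by (rule order_trans[OF nn_integral_mono Ef]) (auto intro: INF_lower)
  ultimately have "(\<integral>\<^sup>+\<omega>. (INF n. f n \<omega>) \<partial>M) \<le> ennreal 0"
    by (intro LIMSEQ_le_const) auto
  then have "AE \<omega> in M. (INF n. f n \<omega>) = 0"
    by (simp add: nn_integral_0_iff_AE)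
  then show ?thesis
  proof (rule AE_mp, intro AE_I2 impI)
    fix \<omega> assume \<omega>: "\<omega> \<in> space M" and 0: "(INF n. f n \<omega>) = 0"
    show "(\<Sum>j. ennreal (Z j \<omega>)) = \<infinity>"
    proof (rule ccontr)
      assume "(\<Sum>j. ennreal (Z j \<omega>)) \<noteq> \<infinity>"
      then have sm: "summable (\<lambda>j. Z j \<omega>)"
        using summable_iff_suminf_neq_top[of "\<lambda>j. Z j \<omega>"] Z01[OF \<omega>] by auto
      have "ennreal (exp (- (\<Sum>j. Z j \<omega>))) \<le> f n \<omega>" for n
      proof -
        have "f n \<omega> = ennreal (\<Prod>j<n. exp (- Z j \<omega>))"
          unfolding f_def by (rule prod_ennreal) simp
        also have "(\<Prod>j<n. exp (- Z j \<omega>)) = exp (- (\<Sum>j<n. Z j \<omega>))"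
          unfolding sum_negf[symmetric] by (rule exp_sum[symmetric]) simp
        finally have "f n \<omega> = ennreal (exp (- (\<Sum>j<n. Z j \<omega>)))" .
        moreover have "(\<Sum>j<n. Z j \<omega>) \<le> (\<Sum>j. Z j \<omega>)"
          using sm Z01[OF \<omega>] by (intro sum_le_suminf) auto
        ultimately show ?thesis
          by (simp add: ennreal_leI)
      qed
      then have "ennreal (exp (- (\<Sum>j. Z j \<omega>))) \<le> 0"
        unfolding 0[symmetric] by (rule INF_greatest)
      then show False
        by (simp add: ennreal_eq_0_iff not_le)
    qed
  qed
qed

end

section \<open>Fixed and random directions\<close>

lemma indep_vars_PiM_projections:
  assumes "\<And>i. i \<in> I \<Longrightarrow> prob_space (M i)" "I \<noteq> {}"
  shows "prob_space.indep_vars (PiM I M) M (\<lambda>i \<omega>. \<omega> i) I"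
proof -
  interpret prob_space "PiM I M"
    by (rule prob_space_PiM) (fact assms)
  have "distr (PiM I M) (PiM I M) (\<lambda>\<omega>. \<lambda>i\<in>I. \<omega> i) = distr (PiM I M) (PiM I M) (\<lambda>\<omega>. \<omega>)"
    by (rule distr_cong) (auto simp: space_PiM)
  also have "\<dots> = PiM I (\<lambda>i. distr (PiM I M) (M i) (\<lambda>\<omega>. \<omega> i))"
    by (simp add: assms distr_PiM_component cong: PiM_cong)
  finally show ?thesis
    by (subst indep_vars_iff_distr_eq_PiM'[OF assms(2)]) auto
qed

lemma AE_suminf_fixed_directions_finite:
  fixes a :: "nat \<Rightarrow> real ^ 'p" and w :: "nat \<Rightarrow> real"
  assumes p: "CARD('p) \<ge> 2"
    and w: "\<And>j. 0 < w j" "\<And>j. w j \<le> 1"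
    and entropy: "summable (\<lambda>j. w j * ln (exp 1 / w j))"
    and a: "\<And>j. norm (a j) = 1"
  shows "AE u in uniform_sphere. (\<Sum>j. ennreal (w j) / ennreal \<bar>a j \<bullet> u\<bar>) < \<infinity>"
proof -
  interpret prob_space "uniform_sphere :: (real ^ 'p) measure"
    by (rule prob_space_uniform_sphere)
  obtain c C :: real where upper:
    "\<And>(a :: real ^ 'p) t. norm a = 1 \<Longrightarrow> 0 \<le> t \<Longrightarrow> t \<le> 1 \<Longrightarrow>
       emeasure uniform_sphere {x \<in> sphere 0 1. \<bar>a \<bullet> x\<bar> \<le> t} \<le> ennreal (C * t)"
    by (rule uniform_sphere_slab_bounds[OF p]) blast
  show ?thesis
  proof (rule AE_suminf_divide_finite[OF w entropy])
    fix j
    show "random_variable borel (\<lambda>u. \<bar>a j \<bullet> u\<bar>)"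
      by measurable
  next
    fix j :: nat and u :: "real ^ 'p"
    assume "u \<in> space uniform_sphere"
    then show "0 \<le> \<bar>a j \<bullet> u\<bar> \<and> \<bar>a j \<bullet> u\<bar> \<le> 1"
      using Cauchy_Schwarz_ineq2[of "a j" u] by (simp add: a)
  next
    fix j :: nat and t :: real
    assume "0 \<le> t" "t \<le> 1"
    then show "emeasure uniform_sphere {u \<in> space uniform_sphere. \<bar>a j \<bullet> u\<bar> \<le> t} \<le> ennreal (C * t)"
      unfolding space_uniform_sphere by (rule upper[OF a])
  qed
qed

text \<open>
  For a fixed \<open>u\<close> the terms are independent functions of the random directions; the measurability
  of the event of divergence in both variables then allows \<open>u\<close> and the directions to change places.
\<close>

lemma AE_suminf_random_directions_eq_top:
  fixes A :: "nat \<Rightarrow> 'm \<Rightarrow> real ^ 'p" and w :: "nat \<Rightarrow> real"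
  assumes p: "CARD('p) \<ge> 2"
    and w: "\<And>j. 0 < w j" "\<And>j. w j \<le> 1"
    and entropy: "\<not> summable (\<lambda>j. w j * ln (exp 1 / w j))"
    and M: "prob_space M"
    and indep: "prob_space.indep_vars M (\<lambda>_. uniform_sphere) A UNIV"
    and distr: "\<And>j. distr M uniform_sphere (A j) = uniform_sphere"
  shows "AE \<omega> in M. AE u in uniform_sphere. (\<Sum>j. ennreal (w j) / ennreal \<bar>A j \<omega> \<bullet> u\<bar>) = \<infinity>"
proof -
  interpret prob_space M by (rule M)
  interpret S: prob_space "uniform_sphere :: (real ^ 'p) measure"
    by (rule prob_space_uniform_sphere)
  interpret pair_sigma_finite "uniform_sphere :: (real ^ 'p) measure" M ..
  have A [measurable]: "A j \<in> measurable M uniform_sphere" for j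
    using indep by (simp add: indep_vars_def)
  obtain c C :: real where c: "0 < c" and lower:
    "\<And>(a :: real ^ 'p) t. norm a = 1 \<Longrightarrow> 0 \<le> t \<Longrightarrow> t \<le> 1 \<Longrightarrow>
       ennreal (c * t) \<le> emeasure uniform_sphere {x \<in> sphere 0 1. \<bar>a \<bullet> x\<bar> \<le> t}"
    by (rule uniform_sphere_slab_bounds[OF p]) blast
  have wln: "0 \<le> w j * ln (exp 1 / w j)" for j
    using w[of j] by (intro mult_nonneg_nonneg ln_ge_zero) (auto simp: field_simps intro: order_trans[of _ 1])
  have fixed_u: "AE \<omega> in M. (\<Sum>j. ennreal (w j) / ennreal \<bar>A j \<omega> \<bullet> u\<bar>) = \<infinity>"
    if u: "norm u = 1" for u :: "real ^ 'p"
  proof -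
    define Z where "Z j \<omega> = w j / max \<bar>A j \<omega> \<bullet> u\<bar> (w j)" for j \<omega>
    have "indep_vars (\<lambda>_. borel) Z UNIV"
      unfolding Z_def by (rule indep_vars_compose2[OF indep]) measurable
    moreover have "0 \<le> Z j \<omega> \<and> Z j \<omega> \<le> 1" for j \<omega>
      using w(1)[of j] by (auto simp: Z_def less_max_iff_disj)
    moreover have "(\<Sum>j. \<integral>\<^sup>+\<omega>. ennreal (Z j \<omega>) \<partial>M) = \<infinity>"
    proof -
      have "ennreal (c * (w j * ln (exp 1 / w j))) \<le> (\<integral>\<^sup>+\<omega>. ennreal (Z j \<omega>) \<partial>M)" for j
      proof -
        have "ennreal (c * (w j * ln (exp 1 / w j)))
            \<le> (\<integral>\<^sup>+x. ennreal (w j / max \<bar>u \<bullet> x\<bar> (w j)) \<partial>uniform_sphere)"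
        proof (rule S.nn_integral_inverse_max_ge[OF _ _ w c])
          fix x :: "real ^ 'p"
          assume "x \<in> space uniform_sphere"
          then show "0 \<le> \<bar>u \<bullet> x\<bar> \<and> \<bar>u \<bullet> x\<bar> \<le> 1"
            using Cauchy_Schwarz_ineq2[of u x] by (simp add: u)
        next
          fix t :: real
          assume "0 \<le> t" "t \<le> 1"
          then show "ennreal (c * t)
              \<le> emeasure uniform_sphere {x \<in> space uniform_sphere. \<bar>u \<bullet> x\<bar> \<le> t}"
            unfolding space_uniform_sphere by (rule lower[OF u])
        qed measurable
        also have "\<dots> = (\<integral>\<^sup>+x. ennreal (w j / max \<bar>u \<bullet> x\<bar> (w j)) \<partial>distr M uniform_sphere (A j))"
          by (simp only: distr)
        also have "\<dots> = (\<integral>\<^sup>+\<omega>. ennreal (Z j \<omega>) \<partial>M)"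
          unfolding Z_def inner_commute[of _ u] by (rule nn_integral_distr) measurable
        finally show ?thesis .
      qed
      then have "(\<Sum>j. ennreal (c * (w j * ln (exp 1 / w j)))) \<le> (\<Sum>j. \<integral>\<^sup>+\<omega>. ennreal (Z j \<omega>) \<partial>M)"
        by (intro suminf_le) auto
      moreover have "\<not> summable (\<lambda>j. c * (w j * ln (exp 1 / w j)))"
        using entropy c by (subst summable_cmult_iff) simp
      then have "(\<Sum>j. ennreal (c * (w j * ln (exp 1 / w j)))) = top"
        using c wln by (intro summable_iff_suminf_neq_top) auto
      ultimately show ?thesis
        by (simp add: top_unique)
    qed
    ultimately have "AE \<omega> in M. (\<Sum>j. ennreal (Z j \<omega>)) = \<infinity>"
      by (rule AE_suminf_indep_eq_top)
    then show ?thesis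
    proof eventually_elim
      case (elim \<omega>)
      have "ennreal (Z j \<omega>) \<le> ennreal (w j) / ennreal \<bar>A j \<omega> \<bullet> u\<bar>" for j
      proof (cases "A j \<omega> \<bullet> u = 0")
        case True
        \<comment> \<open>a positive weight over \<open>0\<close> is \<open>\<infinity>\<close> in the extended nonnegative reals\<close>
        then show ?thesis
          using w(1)[of j] by (simp add: ennreal_divide_zero)
      next
        case False
        then have "Z j \<omega> \<le> w j / \<bar>A j \<omega> \<bullet> u\<bar>"
          using w(1)[of j] unfolding Z_def by (intro divide_left_mono) auto
        then show ?thesis
          using False w(1)[of j] by (simp add: divide_ennreal ennreal_leI)
      qed
      then have "(\<Sum>j. ennreal (Z j \<omega>)) \<le> (\<Sum>j. ennreal (w j) / ennreal \<bar>A j \<omega> \<bullet> u\<bar>)"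
        by (intro suminf_le) auto
      with elim show ?case
        by (simp add: top_unique)
    qed
  qed
  have [measurable]: "A j \<in> borel_measurable M" for j
    using measurable_comp[OF A[of j] measurable_ident_uniform_sphere] by (simp add: comp_def)
  have [measurable]: "fst \<in> borel_measurable (uniform_sphere \<Otimes>\<^sub>M M)"
    using measurable_comp[OF measurable_fst measurable_ident_uniform_sphere] by (simp add: comp_def)
  have "{x \<in> space (uniform_sphere \<Otimes>\<^sub>M M).
      (\<Sum>j. ennreal (w j) / ennreal \<bar>A j (snd x) \<bullet> fst x\<bar>) = \<infinity>} \<in> sets (uniform_sphere \<Otimes>\<^sub>M M)"
    by measurable
  note AE_commute[OF this]
  moreover have "AE u in uniform_sphere. AE \<omega> in M. (\<Sum>j. ennreal (w j) / ennreal \<bar>A j \<omega> \<bullet> u\<bar>) = \<infinity>"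
    by (rule AE_I2, rule fixed_u) simp
  ultimately show ?thesis by blast
qed

theorem theorem8p4:
  fixes w :: "nat \<Rightarrow> real"
    and N :: "'c measure" and U :: "'c \<Rightarrow> real ^ 'p"
  assumes p: "CARD('p) \<ge> 2"
    and w_pos: "\<And>j. w j > 0" and w_sum: "w sums 1"
    and N: "prob_space N"
    and U: "U \<in> measurable N uniform_sphere" "distr N uniform_sphere U = uniform_sphere"
  shows
    "(summable (\<lambda>j. w j * ln (exp 1 / w j)) \<longleftrightarrow>
      (\<forall>a :: nat \<Rightarrow> real ^ 'p. (\<forall>j. a j \<in> sphere 0 1) \<longrightarrow>
        (AE \<omega> in N. (\<Sum>j. ennreal (w j) / ennreal \<bar>a j \<bullet> U \<omega>\<bar>) < \<infinity>)))
     \<and>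
     (\<not> summable (\<lambda>j. w j * ln (exp 1 / w j)) \<longrightarrow>
      (\<forall>(M :: 'm measure) (A :: nat \<Rightarrow> 'm \<Rightarrow> real ^ 'p).
        prob_space M \<longrightarrow>
        prob_space.indep_vars M (\<lambda>_. uniform_sphere) A UNIV \<longrightarrow>
        (\<forall>j. distr M uniform_sphere (A j) = uniform_sphere) \<longrightarrow>
        (AE \<omega> in M. AE u in uniform_sphere.
          (\<Sum>j. ennreal (w j) / ennreal \<bar>A j \<omega> \<bullet> u\<bar>) = \<infinity>)))"
proof (intro conjI iffI impI allI)
  have w_le_1: "w j \<le> 1" for j
    using sum_le_suminf[of w "{j}"] w_sum w_pos by (auto simp: sums_iff less_imp_le)
  note random = AE_suminf_random_directions_eq_top[OF p w_pos w_le_1]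
  {
    fix a :: "nat \<Rightarrow> real ^ 'p"
    assume entropy: "summable (\<lambda>j. w j * ln (exp 1 / w j))" and a: "\<forall>j. a j \<in> sphere 0 1"
    have "AE u in uniform_sphere. (\<Sum>j. ennreal (w j) / ennreal \<bar>a j \<bullet> u\<bar>) < \<infinity>"
      using a by (intro AE_suminf_fixed_directions_finite[OF p w_pos w_le_1 entropy]) simp
    then have "AE u in distr N uniform_sphere U. (\<Sum>j. ennreal (w j) / ennreal \<bar>a j \<bullet> u\<bar>) < \<infinity>"
      by (simp only: U(2))
    then show "AE \<omega> in N. (\<Sum>j. ennreal (w j) / ennreal \<bar>a j \<bullet> U \<omega>\<bar>) < \<infinity>"
      by (rule AE_distrD[OF U(1)])
  }
  {
    assume finite: "\<forall>a :: nat \<Rightarrow> real ^ 'p. (\<forall>j. a j \<in> sphere 0 1) \<longrightarrow>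
      (AE \<omega> in N. (\<Sum>j. ennreal (w j) / ennreal \<bar>a j \<bullet> U \<omega>\<bar>) < \<infinity>)"
    show "summable (\<lambda>j. w j * ln (exp 1 / w j))"
    proof (rule ccontr)
      assume entropy: "\<not> summable (\<lambda>j. w j * ln (exp 1 / w j))"
      define P :: "(nat \<Rightarrow> real ^ 'p) measure" where "P = PiM UNIV (\<lambda>_. uniform_sphere)"
      have P: "prob_space P"
        unfolding P_def by (intro prob_space_PiM prob_space_uniform_sphere)
      have "AE a in P. AE u in uniform_sphere. (\<Sum>j. ennreal (w j) / ennreal \<bar>a j \<bullet> u\<bar>) = \<infinity>"
        using P unfolding P_def
        by (intro random entropy indep_vars_PiM_projections distr_PiM_component prob_space_uniform_sphere)
          auto
      then have "AE a in P. a \<in> space P \<and>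
          (AE u in uniform_sphere. (\<Sum>j. ennreal (w j) / ennreal \<bar>a j \<bullet> u\<bar>) = \<infinity>)"
        by (auto intro: AE_space)
      then obtain a where a: "a \<in> space P"
        and "AE u in uniform_sphere. (\<Sum>j. ennreal (w j) / ennreal \<bar>a j \<bullet> u\<bar>) = \<infinity>"
        using eventually_happens'[OF prob_space.ae_filter_bot[OF P]] by blast
      then have "AE u in distr N uniform_sphere U. (\<Sum>j. ennreal (w j) / ennreal \<bar>a j \<bullet> u\<bar>) = \<infinity>"
        by (simp only: U(2))
      then have "AE \<omega> in N. (\<Sum>j. ennreal (w j) / ennreal \<bar>a j \<bullet> U \<omega>\<bar>) = \<infinity>"
        by (rule AE_distrD[OF U(1)])
      moreover have "a j \<in> sphere 0 1" for j
        using a by (auto simp: P_def space_PiM PiE_iff)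
      then have "AE \<omega> in N. (\<Sum>j. ennreal (w j) / ennreal \<bar>a j \<bullet> U \<omega>\<bar>) < \<infinity>"
        using finite by blast
      ultimately have "AE \<omega> in N. False"
        by eventually_elim simp
      then show False
        using eventually_happens'[OF prob_space.ae_filter_bot[OF N]] by blast
    qed
  }
  {
    fix M :: "'m measure" and A :: "nat \<Rightarrow> 'm \<Rightarrow> real ^ 'p"
    assume "\<not> summable (\<lambda>j. w j * ln (exp 1 / w j))" "prob_space M"
      "prob_space.indep_vars M (\<lambda>_. uniform_sphere) A UNIV"
      "\<forall>j. distr M uniform_sphere (A j) = uniform_sphere"
    then show "AE \<omega> in M. AE u in uniform_sphere.
        (\<Sum>j. ennreal (w j) / ennreal \<bar>A j \<omega> \<bullet> u\<bar>) = \<infinity>"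
      by (intro random) auto
  }
qed

end
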